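(* The class of inclusions of a strong deformation retract of multipointed $d$-spaces is closed under pushout (in the category $\mathbf{MdTop}_\Delta$ of multipointed $d$-spaces).
   Context: Spaces. A topological space $X$ is $\Delta$-generated if it carries the final topology with respect to all continuous maps $\Delta^n\to X$, $n\ge 0$, from the standard topological simplices. $k_\Delta$ denotes the right adjoint of the inclusion of the full subcategory $\mathbf{Top}_\Delta$ of $\Delta$-generated spaces in all topological spaces (same set, final topology with respect to continuous maps from simplices). $\mathbf{TOP}_\Delta(X,Y)$ is the set of continuous maps endowed with $k_\Delta$ of the compact-open topology (subbasis $\{f : f(h(K))\subset U\}$, $h:K\to X$ continuous with $K$ compact Hausdorff, $U\subset Y$ open). A multipointed $d$-space is a triple $X=(|X|,X^0,\mathbb{P}^{top}X)$ with $|X|$ a $\Delta$-generated space, $X^0\subset |X|$ a subset, and $\mathbb{P}^{top}X$ the disjoint union of sets $\mathbb{P}^{top}_{\alpha,\beta}X$, $(\alpha,\beta)\in X^0\times X^0$, of continuous paths $\phi:[0,1]\to|X|$ with $\phi(0)=\alpha$, $\phi(1)=\beta$, closed under concatenation $\phi_1 *_{1/2}\phi_2$ ($\phi_1(2t)$ for $t\le 1/2$, $\phi_2(2t-1)$ for $t\ge 1/2$, when $\phi_1(1)=\phi_2(0)$) and under $\phi\mapsto\phi\circ\psi$ for $\psi:[0,1]\to[0,1]$ continuous strictly increasing with $\psi(0)=0,\psi(1)=1$. A morphism $f:X\to Y$ is a continuous map $|f|:|X|\to|Y|$ restricting to $f^0:X^0\to Y^0$ such that $|f|\circ\phi\in\mathbb{P}^{top}Y$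 for every $\phi\in\mathbb{P}^{top}X$. $\mathbf{MDTOP}_\Delta(X,Y)$ is the set of morphisms $X\to Y$ with $k_\Delta$ of the relative topology from $\mathbf{TOP}_\Delta(|X|,|Y|)\times\mathbf{Set}(X^0,Y^0)$, the second factor being discrete. A map $i:A\to B$ of multipointed $d$-spaces is an inclusion of a strong deformation retract if there is a continuous map $H:[0,1]\to\mathbf{MDTOP}_\Delta(B,B)$ such that $H(0)=\mathrm{Id}_B$, $H(1)=i\circ r$ where $r:B\to A$ is a map of multipointed $d$-spaces with $r\circ i=\mathrm{Id}_A$, and $|H(t)|(|i|(a))=|i|(a)$ for all $a\in|A|$ and all $t\in[0,1]$. *)

theory Defs
  imports "HOL-Analysis.Analysis" "HOL-Homology.Simplices"
begin

section \<open>Delta-generated spaces\<close>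

text \<open>
  The final topology on the underlying set with respect to all continuous maps from the
  standard simplices.  \<open>singular_simplex n X s\<close> says that \<open>s\<close> is a continuous map from the
  standard \<open>n\<close>-simplex to \<open>X\<close>.
\<close>

definition k_delta :: "'a topology \<Rightarrow> 'a topology" where
  "k_delta X = topology (\<lambda>U. U \<subseteq> topspace X \<and>
     (\<forall>n s. singular_simplex n X s \<longrightarrow>
        openin (subtopology (powertop_real UNIV) (standard_simplex n))
               {x \<in> standard_simplex n. s x \<in> U}))"

definition delta_generated :: "'a topology \<Rightarrow> bool" where
  "delta_generated X \<longleftrightarrow> X = k_delta X"

lemma openin_k_delta:
  "openin (k_delta X) U \<longleftrightarrow> U \<subseteq> topspace X \<and>
     (\<forall>n s. singular_simplex n X s \<longrightarrow>
        openin (subtopology (powertop_real UNIV) (standard_simplex n))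
               {x \<in> standard_simplex n. s x \<in> U})"
proof -
  let ?D = "\<lambda>n. subtopology (powertop_real UNIV) (standard_simplex n)"
  let ?P = "\<lambda>U. U \<subseteq> topspace X \<and> (\<forall>n s. singular_simplex n X s \<longrightarrow>
     openin (?D n) {x \<in> standard_simplex n. s x \<in> U})"
  have "istopology ?P"
    unfolding istopology_def
  proof (intro conjI allI impI)
    fix S T assume S: "?P S" and T: "?P T"
    then show "S \<inter> T \<subseteq> topspace X" by auto
    fix n s assume "singular_simplex n X s"
    then have "openin (?D n) ({x \<in> standard_simplex n. s x \<in> S} \<inter> {x \<in> standard_simplex n. s x \<in> T})"
      using S T by (intro openin_Int) auto
    moreover have "{x \<in> standard_simplex n. s x \<in> S} \<inter> {x \<in> standard_simplex n. s x \<in> T}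
        = {x \<in> standard_simplex n. s x \<in> S \<inter> T}" by auto
    ultimately show "openin (?D n) {x \<in> standard_simplex n. s x \<in> S \<inter> T}" by simp
  next
    fix \<K> assume K: "\<forall>U\<in>\<K>. ?P U"
    then show "\<Union>\<K> \<subseteq> topspace X" by auto
    fix n s assume "singular_simplex n X s"
    then have "openin (?D n) (\<Union>U\<in>\<K>. {x \<in> standard_simplex n. s x \<in> U})"
      using K by (intro openin_Union) auto
    moreover have "(\<Union>U\<in>\<K>. {x \<in> standard_simplex n. s x \<in> U}) = {x \<in> standard_simplex n. s x \<in> \<Union>\<K>}"
      by auto
    ultimately show "openin (?D n) {x \<in> standard_simplex n. s x \<in> \<Union>\<K>}" by simp
  qed
  then show ?thesis
    by (simp add: k_delta_def topology_inverse')
qed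

lemma topspace_k_delta [simp]: "topspace (k_delta X) = topspace X"
proof
  show "topspace (k_delta X) \<subseteq> topspace X"
    by (metis openin_k_delta openin_topspace)
  have "openin (k_delta X) (topspace X)"
    unfolding openin_k_delta
  proof (intro conjI allI impI)
    fix n s assume "singular_simplex n X s"
    then have "{x \<in> standard_simplex n. s x \<in> topspace X} = standard_simplex n"
      by (auto simp: singular_simplex_def continuous_map_def Pi_iff)
    then show "openin (subtopology (powertop_real UNIV) (standard_simplex n))
                 {x \<in> standard_simplex n. s x \<in> topspace X}"
      by (metis openin_topspace topspace_standard_simplex)
  qed simp
  then show "topspace X \<subseteq> topspace (k_delta X)"
    by (rule openin_subset)
qed


section \<open>Mapping spaces\<close>

text \<open>
  A map out of a space is represented by a function that is \<open>undefined\<close> outside the underlying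
  set of its domain, so that equality of maps is equality of functions; \<open>compose\<close> and
  \<open>restrict\<close> (for identities) are those of \<open>HOL-Library.FuncSet\<close>.
\<close>

definition cmaps :: "'a topology \<Rightarrow> 'b topology \<Rightarrow> ('a \<Rightarrow> 'b) set" where
  "cmaps X Y = {f \<in> extensional (topspace X). continuous_map X Y f}"

text \<open>
  In the compact-open topology the compact Hausdorff space \<open>K\<close> may be arbitrary.  Restricting
  it to topologies on the type \<open>'a set set\<close> is no loss: lemma \<open>compact_Hausdorff_image_small\<close>
  below shows that these already give all the sets \<open>h ` topspace K\<close>.
\<close>

definition compact_open :: "'a topology \<Rightarrow> 'b topology \<Rightarrow> ('a \<Rightarrow> 'b) topology" where
  "compact_open X Y = topology_generated_by
     {{f \<in> cmaps X Y. f ` (h ` topspace K) \<subseteq> U} | (K :: 'a set set topology) h U.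
        compact_space K \<and> Hausdorff_space K \<and> continuous_map K X h \<and> openin Y U}"

definition TOP_delta :: "'a topology \<Rightarrow> 'b topology \<Rightarrow> ('a \<Rightarrow> 'b) topology" where
  "TOP_delta X Y = k_delta (compact_open X Y)"

lemma compact_Hausdorff_image_small:
  fixes K :: "'k topology" and X :: "'a topology"
  assumes K: "compact_space K" "Hausdorff_space K" and h: "continuous_map K X h"
  obtains K' :: "'a set set topology" and h' where
    "compact_space K'" "Hausdorff_space K'" "continuous_map K' X h'"
    "h' ` topspace K' = h ` topspace K"
proof -
  define S where "S = h ` topspace K"
  define k where "k = inv_into (topspace K) h"
  have k: "k s \<in> topspace K" "h (k s) = s" if "s \<in> S" for s
    using that by (auto simp: S_def k_def inv_into_into f_inv_into_f)
  define C where "C = K closure_of (k ` S)"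
  define L where "L = subtopology K C"
  have CK: "C \<subseteq> topspace K"
    by (simp add: C_def closure_of_subset_topspace)
  then have topL: "topspace L = C"
    by (auto simp: L_def)
  have kC: "k ` S \<subseteq> C"
    unfolding C_def by (rule closure_of_subset) (use k in auto)
  have L: "compact_space L" "Hausdorff_space L"
    using K by (auto simp: L_def C_def closedin_compact_space compact_space_subtopology
        Hausdorff_space_subtopology)
  define e where "e = (\<lambda>x. {{s \<in> S. k s \<in> V} | V. openin K V \<and> x \<in> V})"
  have "inj_on e C"
  proof (rule inj_onI, rule ccontr)
    fix x y assume xy: "x \<in> C" "y \<in> C" "e x = e y" "x \<noteq> y"
    then obtain U V where UV: "openin K U" "openin K V" "x \<in> U" "y \<in> V" "disjnt U V"
      using K(2) CK unfolding Hausdorff_space_def by (meson subsetD)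
    then have "{s \<in> S. k s \<in> U} \<in> e x"
      by (auto simp: e_def)
    then have "{s \<in> S. k s \<in> U} \<in> e y"
      by (simp add: xy(3))
    then obtain W where W: "openin K W" "y \<in> W" "{s \<in> S. k s \<in> U} = {s \<in> S. k s \<in> W}"
      unfolding e_def by blast
    have "openin K (V \<inter> W)" "y \<in> V \<inter> W"
      using UV W by auto
    then obtain s where "s \<in> S" "k s \<in> V \<inter> W"
      using xy(2) unfolding C_def in_closure_of by blast
    then show False
      using W(3) UV(5) by (auto simp: disjnt_iff)
  qed
  define g where "g = inv_into C e"
  have ge: "g (e x) = x" if "x \<in> C" for x
    using that \<open>inj_on e C\<close> by (simp add: g_def)
  define K' where "K' = pullback_topology (e ` C) g L"
  have topK': "topspace K' = e ` C"
    by (auto simp: K'_def topspace_pullback_topology topL ge)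
  have cg: "continuous_map K' L g"
    using continuous_map_pullback[OF continuous_map_id, where A = "e ` C" and f = g] by (simp add: K'_def)
  have ce: "continuous_map L K' e"
    unfolding K'_def
  proof (rule continuous_map_pullback')
    show "continuous_map L L (g \<circ> e)"
      by (rule continuous_map_eq[OF continuous_map_id]) (auto simp: topL ge)
    show "topspace L \<subseteq> e -` (e ` C)"
      by (auto simp: topL)
  qed
  have "homeomorphic_maps L K' e g"
    unfolding homeomorphic_maps_def using cg ce by (auto simp: topL topK' ge)
  then have hom: "L homeomorphic_space K'"
    by (auto simp: homeomorphic_space_def)
  have hL: "continuous_map L X h"
    using h by (simp add: L_def continuous_map_from_subtopology)
  show thesis
  proof
    show "compact_space K'" "Hausdorff_space K'"
      using L hom homeomorphic_compact_space homeomorphic_Hausdorff_space by blast+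
    show "continuous_map K' X (h \<circ> g)"
      using cg hL continuous_map_compose by blast
    have "(h \<circ> g) ` topspace K' = h ` C"
      by (force simp: topK' ge image_iff)
    also have "\<dots> = h ` topspace K"
    proof
      show "h ` C \<subseteq> h ` topspace K"
        using CK by blast
      show "h ` topspace K \<subseteq> h ` C"
        using kC k(2) unfolding S_def[symmetric] by (metis image_eqI image_subset_iff subsetI)
    qed
    finally show "(h \<circ> g) ` topspace K' = h ` topspace K" .
  qed
qed


section \<open>Multipointed d-spaces\<close>

text \<open>
  The component of \<open>paths X\<close> from \<open>a\<close> to \<open>b\<close> consists of the \<open>p \<in> paths X\<close> with \<open>p 0 = a\<close>
  and \<open>p 1 = b\<close>.
\<close>

record 'a mdspace =
  mdtop :: "'a topology"
  states :: "'a set"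
  paths :: "(real \<Rightarrow> 'a) set"

definition path_concat :: "(real \<Rightarrow> 'a) \<Rightarrow> (real \<Rightarrow> 'a) \<Rightarrow> real \<Rightarrow> 'a" where
  "path_concat p q = (\<lambda>t\<in>{0..1}. if t \<le> 1/2 then p (2 * t) else q (2 * t - 1))"

definition multipointed_d_space :: "'a mdspace \<Rightarrow> bool" where
  "multipointed_d_space X \<longleftrightarrow>
     delta_generated (mdtop X) \<and>
     states X \<subseteq> topspace (mdtop X) \<and>
     (\<forall>p \<in> paths X. p \<in> extensional {0..1} \<and> pathin (mdtop X) p \<and>
        p 0 \<in> states X \<and> p 1 \<in> states X) \<and>
     (\<forall>p \<in> paths X. \<forall>q \<in> paths X. p 1 = q 0 \<longrightarrow> path_concat p q \<in> paths X) \<and>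
     (\<forall>p \<in> paths X. \<forall>\<psi>. continuous_on {0..1} \<psi> \<and> strict_mono_on {0..1} \<psi> \<and>
        \<psi> 0 = 0 \<and> \<psi> 1 = 1 \<longrightarrow> compose {0..1} p \<psi> \<in> paths X)"

definition md_hom :: "'a mdspace \<Rightarrow> 'b mdspace \<Rightarrow> ('a \<Rightarrow> 'b) set" where
  "md_hom X Y = {f \<in> cmaps (mdtop X) (mdtop Y).
     f ` states X \<subseteq> states Y \<and> (\<forall>p \<in> paths X. compose {0..1} f p \<in> paths Y)}"

definition md_comp :: "'a mdspace \<Rightarrow> ('b \<Rightarrow> 'c) \<Rightarrow> ('a \<Rightarrow> 'b) \<Rightarrow> 'a \<Rightarrow> 'c" where
  "md_comp X g f = compose (topspace (mdtop X)) g f"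

definition md_id :: "'a mdspace \<Rightarrow> 'a \<Rightarrow> 'a" where
  "md_id X = (\<lambda>x\<in>topspace (mdtop X). x)"

definition MDTOP_delta :: "'a mdspace \<Rightarrow> 'b mdspace \<Rightarrow> ('a \<Rightarrow> 'b) topology" where
  "MDTOP_delta X Y = k_delta (pullback_topology (md_hom X Y) (\<lambda>f. (f, restrict f (states X)))
     (prod_topology (TOP_delta (mdtop X) (mdtop Y))
        (discrete_topology (states X \<rightarrow>\<^sub>E states Y))))"

definition sdr_inclusion :: "'a mdspace \<Rightarrow> 'b mdspace \<Rightarrow> ('a \<Rightarrow> 'b) \<Rightarrow> bool" where
  "sdr_inclusion A B i \<longleftrightarrow>
     multipointed_d_space A \<and> multipointed_d_space B \<and> i \<in> md_hom A B \<and>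
     (\<exists>H r. continuous_map (top_of_set {0..1::real}) (MDTOP_delta B B) H \<and>
        r \<in> md_hom B A \<and>
        H 0 = md_id B \<and> H 1 = md_comp B i r \<and> md_comp A r i = md_id A \<and>
        (\<forall>a \<in> topspace (mdtop A). \<forall>t \<in> {0..1}. H t (i a) = i a))"

text \<open>
  Pushout squares, with \<open>i\<close> and \<open>f\<close> out of \<open>A\<close>, and \<open>g\<close>, \<open>j\<close> into \<open>D\<close>:
  \<open>g \<circ> i = j \<circ> f\<close>.  The type \<open>'u\<close> plays the role of the universe in
  which the underlying sets of all objects of the category live.  As long as \<open>'u\<close> is infinite,
  it contains the underlying set of a pushout of any span of objects over \<open>'u\<close>
  (a quotient of the disjoint union of the sets of \<open>B\<close> and \<open>C\<close>), so that testing the universal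
  property against the objects over \<open>'u\<close> is the same as testing it against objects
  of arbitrary size.
\<close>

definition md_pushout ::
  "'u mdspace \<Rightarrow> 'u mdspace \<Rightarrow> 'u mdspace \<Rightarrow> 'u mdspace \<Rightarrow>
   ('u \<Rightarrow> 'u) \<Rightarrow> ('u \<Rightarrow> 'u) \<Rightarrow> ('u \<Rightarrow> 'u) \<Rightarrow> ('u \<Rightarrow> 'u) \<Rightarrow> bool" where
  "md_pushout A B C D i f g j \<longleftrightarrow>
     multipointed_d_space A \<and> multipointed_d_space B \<and>
     multipointed_d_space C \<and> multipointed_d_space D \<and>
     i \<in> md_hom A B \<and> f \<in> md_hom A C \<and> g \<in> md_hom B D \<and> j \<in> md_hom C D \<and>
     md_comp A g i = md_comp A j f \<and>
     (\<forall>Z :: 'u mdspace. multipointed_d_space Z \<longrightarrow>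
        (\<forall>u \<in> md_hom B Z. \<forall>v \<in> md_hom C Z. md_comp A u i = md_comp A v f \<longrightarrow>
           (\<exists>!w. w \<in> md_hom D Z \<and> md_comp B w g = u \<and> md_comp C w j = v)))"

end

theory Submission
  imports Defs
begin

text \<open>
  The universal property extends the deformation \<open>H\<close> of \<open>B\<close> to \<open>H' t : D \<rightarrow> D\<close> with
  \<open>H' t \<circ> g = g \<circ> H t\<close> and \<open>H' t \<circ> j = j\<close>; only the continuity of \<open>H'\<close> in \<open>t\<close> needs work.
  Since \<open>B\<close> is Delta-generated and simplices are compact Hausdorff,
  \<open>{b. \<forall>t\<in>J. H t b \<in> V}\<close> is open for compact \<open>J\<close> and open \<open>V\<close>.  As \<open>D\<close> carries the final
  topology of \<open>g\<close> and \<open>j\<close>, the same holds for \<open>H'\<close>, and compactness of the test space \<open>K\<close>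
  then gives continuity into the compact-open topology.  The coreflection
  \<open>k_delta\<close> is harmless because the interval is Delta-generated.
\<close>

section \<open>Delta-generated spaces and the unit interval\<close>

lemma openin_imp_openin_k_delta:
  assumes "openin X U"
  shows "openin (k_delta X) U"
  unfolding openin_k_delta
proof (intro conjI allI impI)
  show "U \<subseteq> topspace X"
    using assms by (rule openin_subset)
  fix n s assume "singular_simplex n X s"
  then show "openin (subtopology (powertop_real UNIV) (standard_simplex n))
               {x \<in> standard_simplex n. s x \<in> U}"
    using assms openin_continuous_map_preimage[of _ X s U]
    by (fastforce simp: singular_simplex_def)
qed

lemma continuous_map_from_k_delta: "continuous_map (k_delta X) X id"
  by (auto simp: continuous_map_def openin_imp_openin_k_delta Collect_conj_eq Int_absorb1
      dest: openin_subset)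

lemma delta_generatedI:
  assumes "\<And>U. openin (k_delta X) U \<Longrightarrow> openin X U"
  shows "delta_generated X"
  unfolding delta_generated_def topology_eq using assms openin_imp_openin_k_delta by blast

lemma openin_delta_generatedI:
  assumes "delta_generated X" "U \<subseteq> topspace X"
    and "\<And>n s. singular_simplex n X s \<Longrightarrow>
      openin (subtopology (powertop_real UNIV) (standard_simplex n)) {x \<in> standard_simplex n. s x \<in> U}"
  shows "openin X U"
proof -
  have "openin (k_delta X) U"
    using assms by (simp add: openin_k_delta)
  then show ?thesis
    using assms(1) by (simp add: delta_generated_def)
qed

text \<open>The interval is homeomorphic to the standard 1-simplex, hence Delta-generated.\<close>

lemma continuous_map_interval_k_delta_iff:
  "continuous_map (top_of_set {0..1::real}) (k_delta Y) f
     \<longleftrightarrow> continuous_map (top_of_set {0..1}) Y f"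
proof
  assume "continuous_map (top_of_set {0..1}) (k_delta Y) f"
  then show "continuous_map (top_of_set {0..1}) Y f"
    using continuous_map_compose[OF _ continuous_map_from_k_delta] by (metis id_comp)
next
  assume f: "continuous_map (top_of_set {0..1}) Y f"
  let ?S = "subtopology (powertop_real UNIV) (standard_simplex 1)"
  \<comment> \<open>The zeroth barycentric coordinate identifies the 1-simplex with the interval,
    and \<open>s\<close> is \<open>f\<close> transported along it; \<open>e\<close> is the inverse.
    The restriction makes \<open>s\<close> extensional, as a singular simplex has to be.\<close>
  define s where "s = restrict (\<lambda>x. f (x 0)) (standard_simplex 1)"
  define e :: "real \<Rightarrow> nat \<Rightarrow> real" where "e = (\<lambda>t i. if i = 0 then t else if i = 1 then 1 - t else 0)"
  have e_comp: "continuous_map (top_of_set {0..1}) euclideanreal (\<lambda>t. e t i)" for i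
    by (cases "i = 0"; cases "i = 1") (auto simp: e_def intro!: continuous_intros)
  have "e \<in> {0..1} \<rightarrow> standard_simplex 1"
    by (auto simp: e_def standard_simplex_def)
  then have e: "continuous_map (top_of_set {0..1}) ?S e"
    using e_comp by (simp add: continuous_map_in_subtopology continuous_map_componentwise_UNIV)
  have "continuous_map ?S (top_of_set {0..1}) (\<lambda>x. x 0)"
    by (auto simp: continuous_map_in_subtopology standard_simplex_def
        intro!: continuous_map_from_subtopology continuous_map_product_projection)
  from continuous_map_compose[OF this f] have "continuous_map ?S Y s"
    by (rule continuous_map_eq) (auto simp: s_def)
  then have s: "singular_simplex 1 Y s"
    by (simp add: singular_simplex_def s_def)
  have se: "s (e t) = f t" if "t \<in> {0..1}" for t
    using that \<open>e \<in> _\<close> by (auto simp: s_def e_def Pi_iff)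
  show "continuous_map (top_of_set {0..1}) (k_delta Y) f"
    unfolding continuous_map_def
  proof (intro conjI allI impI)
    show "f \<in> topspace (top_of_set {0..1}) \<rightarrow> topspace (k_delta Y)"
      using f by (simp add: continuous_map_def)
    fix U assume "openin (k_delta Y) U"
    then have "openin ?S {x \<in> standard_simplex 1. s x \<in> U}"
      using s by (auto simp: openin_k_delta)
    from openin_continuous_map_preimage[OF e this]
    have "openin (top_of_set {0..1}) {t \<in> {0..1}. e t \<in> standard_simplex 1 \<and> s (e t) \<in> U}"
      by simp
    also have "{t \<in> {0..1}. e t \<in> standard_simplex 1 \<and> s (e t) \<in> U}
        = {t \<in> topspace (top_of_set {0..1}). f t \<in> U}"
      using se \<open>e \<in> _\<close> by (auto simp: Pi_iff)
    finally show "openin (top_of_set {0..1}) {t \<in> topspace (top_of_set {0..1}). f t \<in> U}" .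
  qed
qed

lemma compact_space_standard_simplex:
  "compact_space (subtopology (powertop_real UNIV) (standard_simplex n))"
  by (rule compact_space_subtopology[OF compactin_standard_simplex])

lemma Hausdorff_space_standard_simplex:
  "Hausdorff_space (subtopology (powertop_real UNIV) (standard_simplex n))"
  by (intro Hausdorff_space_subtopology) (simp add: Hausdorff_space_product_topology)

lemma neighbourhood_base_ofE:
  assumes "neighbourhood_base_of P X" "openin X W" "x \<in> W"
  obtains U V where "openin X U" "P V" "x \<in> U" "U \<subseteq> V" "V \<subseteq> W"
  using neighbourhood_base_of[THEN iffD1, OF assms(1), rule_format, OF conjI[OF assms(2,3)]]
  by (elim exE conjE) (rule that)

section \<open>Maps into the compact-open topology\<close>

text \<open>Continuity into a generated topology is tested on the generating sets; the clause on
  \<open>cmaps\<close> appears because their union is the whole carrier.\<close>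

lemma continuous_map_compact_open_iff:
  fixes X :: "'a topology" and Y :: "'b topology"
  shows "continuous_map T (compact_open X Y) H \<longleftrightarrow>
    (\<forall>t \<in> topspace T. H t \<in> cmaps X Y) \<and>
    (\<forall>(K :: 'a set set topology) h U. compact_space K \<longrightarrow> Hausdorff_space K \<longrightarrow>
       continuous_map K X h \<longrightarrow> openin Y U \<longrightarrow>
       openin T {t \<in> topspace T. H t ` (h ` topspace K) \<subseteq> U})"
    (is "?L \<longleftrightarrow> ?R1 \<and> ?R2")
proof -
  let ?W = "\<lambda>(K :: 'a set set topology) h U. {f \<in> cmaps X Y. f ` (h ` topspace K) \<subseteq> U}"
  let ?P = "\<lambda>(K :: 'a set set topology) h U.
    compact_space K \<and> Hausdorff_space K \<and> continuous_map K X h \<and> openin Y U"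
  define S where "S = {?W K h U | K h U. ?P K h U}"
  have SI: "?W K h U \<in> S" if "?P K h U" for K h U
    unfolding S_def using that by blast
  have SE: "\<exists>K h U. W = ?W K h U \<and> ?P K h U" if "W \<in> S" for W
    using that unfolding S_def by blast
  \<comment> \<open>With the empty test space the image condition is vacuous, so this generating set
    is all of \<open>cmaps X Y\<close>.\<close>
  have "?W (discrete_topology {}) undefined {} \<in> S"
    by (rule SI) (simp add: compact_space_discrete_topology)
  then have "cmaps X Y \<in> S"
    by simp
  moreover have "W \<subseteq> cmaps X Y" if "W \<in> S" for W
    using SE[OF that] by blast
  ultimately have US: "\<Union>S = cmaps X Y"
    by blast
  have L: "?L \<longleftrightarrow> (\<forall>W. W \<in> S \<longrightarrow> openin T (H -` W \<inter> topspace T)) \<and> H ` topspace T \<subseteq> cmaps X Y"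
    unfolding compact_open_def S_def[symmetric] continuous_on_generated_topo_iff US ..
  have eq: "H -` {f \<in> cmaps X Y. f ` A \<subseteq> U} \<inter> topspace T = {t \<in> topspace T. H t ` A \<subseteq> U}"
    if "H ` topspace T \<subseteq> cmaps X Y" for A U
    using that by auto
  show ?thesis
  proof
    assume ?L
    then have R1: "H ` topspace T \<subseteq> cmaps X Y"
      and R2: "\<And>W. W \<in> S \<Longrightarrow> openin T (H -` W \<inter> topspace T)"
      by (simp_all add: L)
    from R2[OF SI] show "?R1 \<and> ?R2"
      unfolding eq[OF R1] using R1 by blast
  next
    assume R: "?R1 \<and> ?R2"
    then have R1: "H ` topspace T \<subseteq> cmaps X Y"
      by blast
    have "openin T (H -` W \<inter> topspace T)" if W: "W \<in> S" for W
    proof -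
      obtain K h U where K: "W = ?W K h U" "?P K h U"
        using SE[OF W] by blast
      then show ?thesis
        unfolding K(1) eq[OF R1] using R by blast
    qed
    with R1 show ?L
      by (simp add: L)
  qed
qed

text \<open>Only the image of the test space matters, so by
  \<open>compact_Hausdorff_image_small\<close> the type of \<open>K\<close> may be arbitrary.
  Simplices and their compact subspaces thus become available as test spaces.\<close>

lemma openin_compact_open_preimage:
  assumes "continuous_map T (compact_open X Y) H"
    and "compact_space K" "Hausdorff_space K" "continuous_map K X h" "openin Y U"
  shows "openin T {t \<in> topspace T. H t ` (h ` topspace K) \<subseteq> U}"
proof -
  obtain K' :: "'b set set topology" and h' where K': "compact_space K'" "Hausdorff_space K'"
    "continuous_map K' X h'" and eq: "h' ` topspace K' = h ` topspace K"
    by (rule compact_Hausdorff_image_small[OF assms(2-4)])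
  from continuous_map_compact_open_iff[THEN iffD1, OF assms(1), THEN conjunct2, rule_format, OF K' assms(5)]
  show ?thesis
    unfolding eq .
qed

text \<open>A one-point test space turns the subbasic sets into conditions on the value at
  \<open>x\<close>.\<close>

lemma continuous_map_compact_open_pointwise:
  assumes "continuous_map T (compact_open X Y) H" "x \<in> topspace X"
  shows "continuous_map T Y (\<lambda>t. H t x)"
  unfolding continuous_map_def
proof (intro conjI allI impI)
  have "continuous_map X Y (H t)" if "t \<in> topspace T" for t
    using assms(1) that by (auto simp: continuous_map_compact_open_iff cmaps_def)
  then show "(\<lambda>t. H t x) \<in> topspace T \<rightarrow> topspace Y"
    using assms(2) by (auto simp: continuous_map_def Pi_iff)
  fix U assume "openin Y U"
  then have "openin T {t \<in> topspace T. H t ` ((\<lambda>_. x) ` topspace (discrete_topology {()})) \<subseteq> U}"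
    using assms by (intro openin_compact_open_preimage) (auto simp: compact_space_discrete_topology)
  then show "openin T {t \<in> topspace T. H t x \<in> U}"
    by simp
qed

text \<open>Evaluation is jointly continuous after pulling back to \<open>S\<close>, because
  \<open>S\<close> is locally compact: near \<open>x\<close> there is a compact \<open>M\<close>
  that \<open>H t \<circ> s\<close> sends into \<open>V\<close>, and \<open>M\<close> can itself
  serve as a test space.\<close>

lemma continuous_map_evaluation_compact_Hausdorff:
  assumes H: "continuous_map T (compact_open X Y) H" and s: "continuous_map S X s"
    and S: "compact_space S" "Hausdorff_space S" and V: "openin Y V"
  shows "openin (prod_topology S T) {(x, t). x \<in> topspace S \<and> t \<in> topspace T \<and> H t (s x) \<in> V}"
    (is "openin _ ?Q")
proof (subst openin_subopen, intro ballI)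
  fix z assume "z \<in> ?Q"
  then obtain x t where z: "z = (x, t)" and xt: "x \<in> topspace S" "t \<in> topspace T" "H t (s x) \<in> V"
    by auto
  have "continuous_map X Y (H t)"
    using H xt by (auto simp: continuous_map_compact_open_iff cmaps_def)
  from openin_continuous_map_preimage[OF continuous_map_compose[OF s this] V]
  have W: "openin S {x \<in> topspace S. H t (s x) \<in> V}"
    by (simp add: o_def)
  have base: "neighbourhood_base_of (compactin S) S"
    using S locally_compact_space_neighbourhood_base compact_imp_locally_compact_space by blast
  have "x \<in> {x \<in> topspace S. H t (s x) \<in> V}"
    using xt by simp
  from neighbourhood_base_ofE[OF base W this] obtain N M where
    NM: "openin S N" "compactin S M" "x \<in> N" "N \<subseteq> M" "M \<subseteq> {x \<in> topspace S. H t (s x) \<in> V}" .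
  \<comment> \<open>The test space is \<open>M\<close> with the map \<open>s\<close>, so
    \<open>A\<close> is open in \<open>T\<close>, and \<open>N \<times> A\<close> is the required
    box around \<open>(x, t)\<close>.\<close>
  define A where "A = {t \<in> topspace T. H t ` (s ` topspace (subtopology S M)) \<subseteq> V}"
  have "openin T A"
    unfolding A_def using H _ _ _ V
    by (rule openin_compact_open_preimage)
       (use NM S s in \<open>auto simp: compact_space_subtopology Hausdorff_space_subtopology
          continuous_map_from_subtopology\<close>)
  moreover have "topspace (subtopology S M) = M"
    using compactin_subset_topspace[OF NM(2)] by auto
  then have A: "A = {t \<in> topspace T. \<forall>x\<in>M. H t (s x) \<in> V}"
    unfolding A_def by auto
  have "N \<times> A \<subseteq> ?Q"
    using NM(4) openin_subset[OF NM(1)] unfolding A by blast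
  moreover have "z \<in> N \<times> A"
    using NM(3,5) xt unfolding z A by blast
  ultimately show "\<exists>U. openin (prod_topology S T) U \<and> z \<in> U \<and> U \<subseteq> ?Q"
    using NM(1) by (intro exI[of _ "N \<times> A"] conjI) (simp_all add: openin_prod_Times_iff)
qed

text \<open>Openness in \<open>X\<close> is tested along simplices, which are compact Hausdorff, so
  the evaluation lemma applies there. Compactness of \<open>J\<close> then allows the universal
  quantifier over \<open>t\<close>.\<close>

lemma openin_forall_compact_preimage:
  assumes H: "continuous_map T (compact_open X Y) H" and X: "delta_generated X"
    and J: "compactin T J" and V: "openin Y V"
  shows "openin X {x \<in> topspace X. \<forall>t\<in>J. H t x \<in> V}"
proof (rule openin_delta_generatedI[OF X])
  fix n s assume "singular_simplex n X s"
  let ?S = "subtopology (powertop_real UNIV) (standard_simplex n)"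
  let ?Q = "{(x, t). x \<in> topspace ?S \<and> t \<in> topspace T \<and> H t (s x) \<in> V}"
  have s: "continuous_map ?S X s"
    using \<open>singular_simplex n X s\<close> by (simp add: singular_simplex_def)
  have Q: "openin (prod_topology ?S T) ?Q"
    using H s compact_space_standard_simplex Hausdorff_space_standard_simplex V
    by (rule continuous_map_evaluation_compact_Hausdorff)
  have JT: "J \<subseteq> topspace T"
    using J by (rule compactin_subset_topspace)
  show "openin ?S {x \<in> standard_simplex n. s x \<in> {x \<in> topspace X. \<forall>t\<in>J. H t x \<in> V}}"
  proof (subst openin_subopen, intro ballI)
    fix x assume x: "x \<in> {x \<in> standard_simplex n. s x \<in> {x \<in> topspace X. \<forall>t\<in>J. H t x \<in> V}}"
    then have "x \<in> topspace ?S" "{x} \<times> J \<subseteq> ?Q"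
      using JT by auto
    \<comment> \<open>The tube lemma thickens the slice \<open>{x} \<times> J\<close> inside the
      open set \<open>?Q\<close> to a box.\<close>
    from tube_lemma_right[OF Q J this] obtain U W where
      UW: "openin ?S U" "openin T W" "x \<in> U" "J \<subseteq> W" "U \<times> W \<subseteq> ?Q"
      by (elim exE conjE) (rule that)
    have "s \<in> standard_simplex n \<rightarrow> topspace X"
      using s by (simp add: continuous_map_def)
    then have "U \<subseteq> {x \<in> standard_simplex n. s x \<in> {x \<in> topspace X. \<forall>t\<in>J. H t x \<in> V}}"
      using UW(4,5) openin_subset[OF UW(1)] by auto
    with UW(1,3) show "\<exists>T. openin ?S T \<and> x \<in> T
        \<and> T \<subseteq> {x \<in> standard_simplex n. s x \<in> {x \<in> topspace X. \<forall>t\<in>J. H t x \<in> V}}"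
      by (intro exI[of _ U] conjI)
  qed
qed auto

text \<open>Pointwise continuity gives, for each point of the compact image, a compact neighbourhood
  of \<open>t0\<close> that works for that point. By the last hypothesis it works for an open set of
  points, so finitely many neighbourhoods suffice.\<close>

lemma continuous_map_into_compact_openI:
  assumes T: "neighbourhood_base_of (compactin T) T"
    and H: "\<And>t. t \<in> topspace T \<Longrightarrow> H t \<in> cmaps X Y"
    and pointwise: "\<And>x. x \<in> topspace X \<Longrightarrow> continuous_map T Y (\<lambda>t. H t x)"
    and compact: "\<And>J U. compactin T J \<Longrightarrow> openin Y U \<Longrightarrow>
      openin X {x \<in> topspace X. \<forall>t\<in>J. H t x \<in> U}"
  shows "continuous_map T (compact_open X Y) H"
  unfolding continuous_map_compact_open_iff
proof (intro conjI ballI allI impI)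
  fix K :: "'b set set topology" and h U
  assume K: "compact_space K" and h: "continuous_map K X h" and U: "openin Y U"
  let ?A = "{t \<in> topspace T. H t ` (h ` topspace K) \<subseteq> U}"
  have hK: "compactin X (h ` topspace K)"
    using K h image_compactin compact_space_def by blast
  show "openin T ?A"
  proof (subst openin_subopen, intro ballI)
    fix t0 assume t0: "t0 \<in> ?A"
    \<comment> \<open>\<open>F\<close> lists the neighbourhoods \<open>J\<close> of
      \<open>t0\<close> with an open core \<open>N\<close>; \<open>R\<close> sends such a pair to
      the open set of points for which all times in \<open>J\<close> are good.\<close>
    define F where "F = {(N, J). openin T N \<and> compactin T J \<and> t0 \<in> N \<and> N \<subseteq> J}"
    define R where "R = (\<lambda>(N :: 'a set, J). {x \<in> topspace X. \<forall>t\<in>J. H t x \<in> U})"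
    have "h ` topspace K \<subseteq> \<Union>(R ` F)"
    proof
      fix x assume "x \<in> h ` topspace K"
      then have x: "x \<in> topspace X" "H t0 x \<in> U"
        using t0 hK compactin_subset_topspace by blast+
      have "openin T {t \<in> topspace T. H t x \<in> U}" "t0 \<in> {t \<in> topspace T. H t x \<in> U}"
        using openin_continuous_map_preimage[OF pointwise[OF x(1)] U] t0 x(2) by auto
      from neighbourhood_base_ofE[OF T this] obtain N J where
        "openin T N" "compactin T J" "t0 \<in> N" "N \<subseteq> J" "J \<subseteq> {t \<in> topspace T. H t x \<in> U}" .
      then have "(N, J) \<in> F" "x \<in> R (N, J)"
        using x by (auto simp: F_def R_def)
      then show "x \<in> \<Union>(R ` F)"
        by blast
    qed
    moreover have "\<forall>V \<in> R ` F. openin X V"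
      using compact U by (auto simp: R_def F_def)
    ultimately have "\<exists>G. finite G \<and> G \<subseteq> R ` F \<and> h ` topspace K \<subseteq> \<Union>G"
      using hK unfolding compactin_def by simp
    then obtain G where G: "finite G" "G \<subseteq> R ` F" "h ` topspace K \<subseteq> \<Union>G"
      by (elim exE conjE)
    from finite_subset_image[OF G(1,2)] obtain F' where "F' \<subseteq> F" "finite F'" "G = R ` F'"
      by (elim exE conjE)
    with G(3) have F': "finite F'" "F' \<subseteq> F" "h ` topspace K \<subseteq> \<Union>(R ` F')"
      by simp_all
    \<comment> \<open>The factor \<open>topspace T\<close> matters when \<open>F'\<close> is empty,
      where the intersection alone would be \<open>UNIV\<close>.\<close>
    define M where "M = topspace T \<inter> \<Inter>(fst ` F')"
    have "openin T M"
    proof (cases "F' = {}")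
      case False
      then have "openin T (\<Inter>(fst ` F'))"
        using F' by (intro openin_Inter) (auto simp: F_def)
      then show ?thesis
        by (simp add: M_def openin_Int)
    qed (simp add: M_def)
    moreover have "t0 \<in> M"
      using F' t0 by (auto simp: M_def F_def)
    moreover have "M \<subseteq> ?A"
    proof (rule subsetI)
      fix t assume t: "t \<in> M"
      have "H t x \<in> U" if x: "x \<in> h ` topspace K" for x
      proof -
        obtain N J where NJ: "(N, J) \<in> F'" "x \<in> R (N, J)"
          using F'(3) x by auto
        then have "t \<in> J"
          using t F'(2) by (force simp: M_def F_def)
        then show "H t x \<in> U"
          using NJ by (simp add: R_def)
      qed
      moreover have "t \<in> topspace T"
        using t by (simp add: M_def)
      ultimately show "t \<in> ?A"
        by (simp add: image_subset_iff)
    qed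
    ultimately show "\<exists>N. openin T N \<and> t0 \<in> N \<and> N \<subseteq> ?A"
      by (intro exI[of _ M] conjI)
  qed
qed (rule H)

section \<open>Multipointed d-spaces\<close>

text \<open>The mapping property of an initial topology; it resolves the relative topology in
  \<open>MDTOP_delta\<close>.\<close>

lemma continuous_map_into_pullback_topology_iff:
  "continuous_map T (pullback_topology A f Y) g \<longleftrightarrow> g ` topspace T \<subseteq> A \<and> continuous_map T Y (f \<circ> g)"
proof
  assume g: "continuous_map T (pullback_topology A f Y) g"
  have "continuous_map (pullback_topology A f Y) Y (id \<circ> f)"
    by (rule continuous_map_pullback) (rule continuous_map_id)
  then have "continuous_map (pullback_topology A f Y) Y f"
    by simp
  with g have "continuous_map T Y (f \<circ> g)"
    by (rule continuous_map_compose)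
  moreover have "g ` topspace T \<subseteq> topspace (pullback_topology A f Y)"
    using g by (rule continuous_map_image_subset_topspace)
  ultimately show "g ` topspace T \<subseteq> A \<and> continuous_map T Y (f \<circ> g)"
    unfolding topspace_pullback_topology by blast
next
  assume "g ` topspace T \<subseteq> A \<and> continuous_map T Y (f \<circ> g)"
  then show "continuous_map T (pullback_topology A f Y) g"
    by (intro continuous_map_pullback') blast+
qed

text \<open>The interval is connected, so a path in the discrete factor of the mapping space is constant.\<close>

lemma continuous_map_interval_MDTOP_delta_iff:
  "continuous_map (top_of_set {0..1::real}) (MDTOP_delta X Y) H \<longleftrightarrow>
     (\<forall>t \<in> {0..1}. H t \<in> md_hom X Y) \<and>
     continuous_map (top_of_set {0..1}) (compact_open (mdtop X) (mdtop Y)) H \<and>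
     (\<forall>t \<in> {0..1}. \<forall>x \<in> states X. H t x = H 0 x)" (is "?L \<longleftrightarrow> ?R")
proof -
  let ?I = "top_of_set {0..1::real}"
  let ?f = "\<lambda>f. (f, restrict f (states X))"
  let ?D = "discrete_topology (states X \<rightarrow>\<^sub>E states Y)"
  let ?P = "prod_topology (TOP_delta (mdtop X) (mdtop Y)) ?D"
  \<comment> \<open>The outer \<open>k_delta\<close> is removed here; the inner one, hidden in
    \<open>TOP_delta\<close>, goes in the next step.\<close>
  have "?L \<longleftrightarrow> (\<forall>t \<in> {0..1}. H t \<in> md_hom X Y) \<and> continuous_map ?I ?P (?f \<circ> H)"
    unfolding MDTOP_delta_def continuous_map_interval_k_delta_iff
      continuous_map_into_pullback_topology_iff by (simp only: image_subset_iff topspace_euclidean_subtopology)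
  also have "\<dots> \<longleftrightarrow> ?R"
  proof -
    have *: "continuous_map ?I ?P (?f \<circ> H) \<longleftrightarrow>
        continuous_map ?I (compact_open (mdtop X) (mdtop Y)) H \<and>
        continuous_map ?I ?D (\<lambda>t. restrict (H t) (states X))"
      unfolding o_def continuous_map_paired TOP_delta_def continuous_map_interval_k_delta_iff ..
    have **: "continuous_map ?I ?D (\<lambda>t. restrict (H t) (states X)) \<longleftrightarrow>
        (\<forall>t \<in> {0..1}. \<forall>x \<in> states X. H t x = H 0 x)"
      if hom: "\<forall>t \<in> {0..1}. H t \<in> md_hom X Y"
    proof
      assume c: "continuous_map ?I ?D (\<lambda>t. restrict (H t) (states X))"
      have "connectedin ?I {0..1}"
        by (simp add: connectedin_subtopology)
      from connectedin_continuous_map_image[OF c this] obtain a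
        where a: "(\<lambda>t. restrict (H t) (states X)) ` {0..1} \<subseteq> {a}"
        unfolding connectedin_discrete_topology by blast
      show "\<forall>t \<in> {0..1}. \<forall>x \<in> states X. H t x = H 0 x"
      proof (intro ballI)
        fix t :: real and x assume "t \<in> {0..1}" "x \<in> states X"
        have "restrict (H s) (states X) = a" if "s \<in> {0..1}" for s
          using a imageI[OF that, of "\<lambda>t. restrict (H t) (states X)"] by (metis singletonD subsetD)
        then have "restrict (H t) (states X) x = restrict (H 0) (states X) x"
          using \<open>t \<in> {0..1}\<close> by simp
        then show "H t x = H 0 x"
          using \<open>x \<in> states X\<close> by simp
      qed
    next
      assume st: "\<forall>t \<in> {0..1}. \<forall>x \<in> states X. H t x = H 0 x"
      have eq: "restrict (H 0) (states X) = restrict (H t) (states X)" if "t \<in> {0..1}" for t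
        by (rule restrict_ext) (rule st[rule_format, OF that, symmetric])
      \<comment> \<open>Morphisms preserve states, so the constant value is indeed a point of the
        discrete space.\<close>
      have "H 0 \<in> md_hom X Y"
        using hom by simp
      then have "restrict (H 0) (states X) \<in> topspace ?D"
        by (simp add: md_hom_def image_subset_iff)
      then have "continuous_map ?I ?D (\<lambda>t. restrict (H 0) (states X))"
        by simp
      then show "continuous_map ?I ?D (\<lambda>t. restrict (H t) (states X))"
        by (rule continuous_map_eq) (use eq in simp)
    qed
    show ?thesis
      unfolding * by (intro conj_cong refl) (rule **)
  qed
  finally show ?thesis .
qed

section \<open>Concatenation of paths and composition of morphisms\<close>

lemma pathin_path_concat:
  assumes p: "pathin X p" and q: "pathin X q" and eq: "p 1 = q 0"
  shows "pathin X (path_concat p q)"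
proof -
  let ?I = "top_of_set {0..1::real}"
  have "continuous_map (subtopology ?I {t \<in> topspace ?I. t \<le> 1/2}) ?I (\<lambda>t. 2 * t)"
       "continuous_map (subtopology ?I {t \<in> topspace ?I. 1/2 \<le> t}) ?I (\<lambda>t. 2 * t - 1)"
    by (auto simp: subtopology_subtopology intro!: continuous_intros)
  then have "continuous_map ?I X (\<lambda>t. if t \<le> 1/2 then (p \<circ> (\<lambda>t. 2 * t)) t else (q \<circ> (\<lambda>t. 2 * t - 1)) t)"
    using p q eq unfolding pathin_def
    by (intro continuous_map_cases_le continuous_map_compose)
       (auto intro!: continuous_intros simp: field_simps)
  then show ?thesis
    unfolding pathin_def by (rule continuous_map_eq) (auto simp: path_concat_def)
qed

lemma md_homD:
  assumes "f \<in> md_hom X Y"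
  shows "f \<in> extensional (topspace (mdtop X))" "continuous_map (mdtop X) (mdtop Y) f"
    "\<And>x. x \<in> topspace (mdtop X) \<Longrightarrow> f x \<in> topspace (mdtop Y)"
    "\<And>x. x \<in> states X \<Longrightarrow> f x \<in> states Y"
    "\<And>p. p \<in> paths X \<Longrightarrow> compose {0..1} f p \<in> paths Y"
  using assms by (auto simp: md_hom_def cmaps_def continuous_map_def)

lemma md_homI:
  assumes "f \<in> extensional (topspace (mdtop X))" "continuous_map (mdtop X) (mdtop Y) f"
    "\<And>x. x \<in> states X \<Longrightarrow> f x \<in> states Y"
    "\<And>p. p \<in> paths X \<Longrightarrow> compose {0..1} f p \<in> paths Y"
  shows "f \<in> md_hom X Y"
  using assms by (auto simp: md_hom_def cmaps_def)

lemma multipointed_d_spaceD: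
  assumes "multipointed_d_space X"
  shows "delta_generated (mdtop X)" "states X \<subseteq> topspace (mdtop X)"
    "\<And>p. p \<in> paths X \<Longrightarrow> p \<in> extensional {0..1}"
    "\<And>p. p \<in> paths X \<Longrightarrow> pathin (mdtop X) p"
    "\<And>p. p \<in> paths X \<Longrightarrow> p 0 \<in> states X"
    "\<And>p. p \<in> paths X \<Longrightarrow> p 1 \<in> states X"
    "\<And>p q. p \<in> paths X \<Longrightarrow> q \<in> paths X \<Longrightarrow> p 1 = q 0 \<Longrightarrow> path_concat p q \<in> paths X"
    "\<And>p \<psi>. p \<in> paths X \<Longrightarrow> continuous_on {0..1} \<psi> \<Longrightarrow> strict_mono_on {0..1} \<psi> \<Longrightarrow>
       \<psi> 0 = 0 \<Longrightarrow> \<psi> 1 = 1 \<Longrightarrow> compose {0..1} p \<psi> \<in> paths X"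
  using assms unfolding multipointed_d_space_def by blast+

lemma md_path_in_topspace:
  assumes "multipointed_d_space X" "p \<in> paths X" "t \<in> {0..1}"
  shows "p t \<in> topspace (mdtop X)"
  using multipointed_d_spaceD(4)[OF assms(1,2)] assms(3)
  by (auto simp: pathin_def continuous_map_def)

lemma md_id_in_md_hom:
  assumes "multipointed_d_space X"
  shows "md_id X \<in> md_hom X X"
proof (rule md_homI)
  show "continuous_map (mdtop X) (mdtop X) (md_id X)"
    by (rule continuous_map_eq[OF continuous_map_id]) (simp add: md_id_def)
  show "md_id X x \<in> states X" if "x \<in> states X" for x
    using that multipointed_d_spaceD(2)[OF assms] by (auto simp: md_id_def)
  fix p assume p: "p \<in> paths X"
  have "compose {0..1} (md_id X) p = p"
    using p md_path_in_topspace[OF assms p] multipointed_d_spaceD(3)[OF assms p]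
    by (auto simp: compose_def md_id_def extensional_def fun_eq_iff)
  then show "compose {0..1} (md_id X) p \<in> paths X"
    using p by simp
qed (simp add: md_id_def)

lemma md_comp_in_md_hom:
  assumes X: "multipointed_d_space X" and f: "f \<in> md_hom X Y" and g: "g \<in> md_hom Y Z"
  shows "md_comp X g f \<in> md_hom X Z"
proof (rule md_homI)
  show "continuous_map (mdtop X) (mdtop Z) (md_comp X g f)"
    by (rule continuous_map_eq[OF continuous_map_compose[OF md_homD(2)[OF f] md_homD(2)[OF g]]])
       (simp add: md_comp_def compose_def)
  show "md_comp X g f x \<in> states Z" if "x \<in> states X" for x
    using that multipointed_d_spaceD(2)[OF X] md_homD(4)[OF f] md_homD(4)[OF g]
    by (auto simp: md_comp_def compose_def)
  fix p assume p: "p \<in> paths X"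
  have "compose {0..1} (md_comp X g f) p = compose {0..1} g (compose {0..1} f p)"
    using md_path_in_topspace[OF X p] by (auto simp: compose_def md_comp_def fun_eq_iff)
  then show "compose {0..1} (md_comp X g f) p \<in> paths Z"
    using md_homD(5)[OF g md_homD(5)[OF f p]] by simp
qed (simp add: md_comp_def)

lemma md_comp_apply: "x \<in> topspace (mdtop X) \<Longrightarrow> md_comp X g f x = g (f x)"
  by (simp add: md_comp_def compose_def)

lemma md_comp_eq_iff: "md_comp X g f = md_comp X g' f' \<longleftrightarrow>
    (\<forall>x \<in> topspace (mdtop X). g (f x) = g' (f' x))"
  by (auto simp: md_comp_def compose_def fun_eq_iff)

lemma md_comp_eqI:
  assumes "h \<in> md_hom X Y" "\<And>x. x \<in> topspace (mdtop X) \<Longrightarrow> g (f x) = h x"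
  shows "md_comp X g f = h"
  using assms md_homD(1)[OF assms(1)] by (auto simp: md_comp_def compose_def fun_eq_iff extensional_def)

section \<open>Pushouts\<close>

lemma openin_preimage_Int:
  assumes "openin X {x \<in> topspace X. f x \<in> S}" "openin X {x \<in> topspace X. f x \<in> T}"
  shows "openin X {x \<in> topspace X. f x \<in> S \<inter> T}"
  using openin_Int[OF assms] by (rule back_subst[of "openin X"]) auto

lemma openin_preimage_Union:
  assumes "\<And>S. S \<in> \<K> \<Longrightarrow> openin X {x \<in> topspace X. f x \<in> S}"
  shows "openin X {x \<in> topspace X. f x \<in> \<Union>\<K>}"
proof -
  have "openin X (\<Union>S\<in>\<K>. {x \<in> topspace X. f x \<in> S})"
    using assms by blast
  then show ?thesis
    by (rule back_subst[of "openin X"]) auto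
qed

text \<open>This is the quotient topology from the disjoint union of \<open>X\<close> and
  \<open>Y\<close>. The carrier is cut down to the two images, since the type \<open>'c\<close> may
  have further points.\<close>

definition final_topology2 ::
  "'a topology \<Rightarrow> 'b topology \<Rightarrow> ('a \<Rightarrow> 'c) \<Rightarrow> ('b \<Rightarrow> 'c) \<Rightarrow> 'c topology" where
  "final_topology2 X Y g j = topology (\<lambda>U. U \<subseteq> g ` topspace X \<union> j ` topspace Y \<and>
     openin X {x \<in> topspace X. g x \<in> U} \<and> openin Y {y \<in> topspace Y. j y \<in> U})"

lemma openin_final_topology2:
  "openin (final_topology2 X Y g j) U \<longleftrightarrow> U \<subseteq> g ` topspace X \<union> j ` topspace Y \<and>
     openin X {x \<in> topspace X. g x \<in> U} \<and> openin Y {y \<in> topspace Y. j y \<in> U}"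
  unfolding final_topology2_def
proof (subst topology_inverse')
  show "istopology (\<lambda>U. U \<subseteq> g ` topspace X \<union> j ` topspace Y \<and>
     openin X {x \<in> topspace X. g x \<in> U} \<and> openin Y {y \<in> topspace Y. j y \<in> U})"
    unfolding istopology_def
    by (intro conjI allI impI openin_preimage_Int openin_preimage_Union Union_least) blast+
qed (rule refl)

lemma topspace_final_topology2:
  "topspace (final_topology2 X Y g j) = g ` topspace X \<union> j ` topspace Y"
proof
  have eq: "{x \<in> topspace X. g x \<in> g ` topspace X \<union> j ` topspace Y} = topspace X"
    "{y \<in> topspace Y. j y \<in> g ` topspace X \<union> j ` topspace Y} = topspace Y"
    by auto
  have "openin (final_topology2 X Y g j) (g ` topspace X \<union> j ` topspace Y)"
    unfolding openin_final_topology2 eq by simp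
  then show "g ` topspace X \<union> j ` topspace Y \<subseteq> topspace (final_topology2 X Y g j)"
    by (rule openin_subset)
  show "topspace (final_topology2 X Y g j) \<subseteq> g ` topspace X \<union> j ` topspace Y"
    by (rule openin_final_topology2[THEN iffD1, OF openin_topspace, THEN conjunct1])
qed

lemma continuous_map_final_topology2:
  "continuous_map X (final_topology2 X Y g j) g" "continuous_map Y (final_topology2 X Y g j) j"
  by (simp_all add: continuous_map_def openin_final_topology2 topspace_final_topology2)

lemma singular_simplex_continuous_compose:
  assumes "singular_simplex n X s" "continuous_map X Y f"
  shows "singular_simplex n Y (restrict (f \<circ> s) (standard_simplex n))"
proof -
  have "continuous_map (subtopology (powertop_real UNIV) (standard_simplex n)) Y (f \<circ> s)"
    using assms by (auto simp: singular_simplex_def intro: continuous_map_compose)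
  then have "continuous_map (subtopology (powertop_real UNIV) (standard_simplex n)) Y
      (restrict (f \<circ> s) (standard_simplex n))"
    by (rule continuous_map_eq) simp
  then show ?thesis
    by (simp add: singular_simplex_def)
qed

text \<open>Composing with \<open>f\<close> turns simplices of \<open>X\<close> into simplices of
  \<open>Y\<close>. This is the coreflection property: \<open>f\<close> remains continuous into
  \<open>k_delta Y\<close>.\<close>

lemma openin_preimage_k_delta:
  assumes X: "delta_generated X" and f: "continuous_map X Y f" and U: "openin (k_delta Y) U"
  shows "openin X {x \<in> topspace X. f x \<in> U}"
proof (rule openin_delta_generatedI[OF X])
  fix n s assume s: "singular_simplex n X s"
  then have "s \<in> standard_simplex n \<rightarrow> topspace X"
    by (simp add: singular_simplex_def continuous_map_def)
  then have eq: "{x \<in> standard_simplex n. s x \<in> {x \<in> topspace X. f x \<in> U}}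
      = {x \<in> standard_simplex n. restrict (f \<circ> s) (standard_simplex n) x \<in> U}"
    by auto
  show "openin (subtopology (powertop_real UNIV) (standard_simplex n))
      {x \<in> standard_simplex n. s x \<in> {x \<in> topspace X. f x \<in> U}}"
    unfolding eq using U singular_simplex_continuous_compose[OF s f] unfolding openin_k_delta by blast
qed auto

text \<open>Both structure maps start at Delta-generated spaces, so they remain continuous into the
  coreflection, and its open sets are already open in the final topology.\<close>

lemma delta_generated_final_topology2:
  assumes "delta_generated X" "delta_generated Y"
  shows "delta_generated (final_topology2 X Y g j)"
proof (rule delta_generatedI)
  fix U assume U: "openin (k_delta (final_topology2 X Y g j)) U"
  then show "openin (final_topology2 X Y g j) U"
    using openin_preimage_k_delta[OF assms(1) continuous_map_final_topology2(1) U]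
      openin_preimage_k_delta[OF assms(2) continuous_map_final_topology2(2) U]
      openin_subset[OF U]
    by (simp add: openin_final_topology2 topspace_final_topology2)
qed

section \<open>Consequences of the universal property\<close>

lemma md_pushoutD:
  assumes "md_pushout A B C D i f g j"
  shows "multipointed_d_space A" "multipointed_d_space B" "multipointed_d_space C"
    "multipointed_d_space D" "i \<in> md_hom A B" "f \<in> md_hom A C" "g \<in> md_hom B D" "j \<in> md_hom C D"
  using assms unfolding md_pushout_def by blast+

lemma md_pushout_commute:
  assumes "md_pushout A B C D i f g j" "a \<in> topspace (mdtop A)"
  shows "g (i a) = j (f a)"
proof -
  have "md_comp A g i = md_comp A j f"
    using assms(1) unfolding md_pushout_def by (elim conjE)
  then show ?thesis
    using assms(2) by (simp add: md_comp_eq_iff)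
qed

lemma md_pushout_universal:
  fixes A B C D Z :: "'u mdspace"
  assumes "md_pushout A B C D i f g j" "multipointed_d_space Z" "u \<in> md_hom B Z" "v \<in> md_hom C Z"
    and "md_comp A u i = md_comp A v f"
  shows "\<exists>!w. w \<in> md_hom D Z \<and> md_comp B w g = u \<and> md_comp C w j = v"
proof -
  have "\<forall>Z :: 'u mdspace. multipointed_d_space Z \<longrightarrow>
        (\<forall>u \<in> md_hom B Z. \<forall>v \<in> md_hom C Z. md_comp A u i = md_comp A v f \<longrightarrow>
           (\<exists>!w. w \<in> md_hom D Z \<and> md_comp B w g = u \<and> md_comp C w j = v))"
    using assms(1) unfolding md_pushout_def by (elim conjE)
  from this[rule_format, OF assms(2-5)] show ?thesis .
qed

text \<open>The existence half of the universal property, with equations between extensional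
  functions replaced by pointwise ones.\<close>

lemma md_pushout_induced:
  fixes A B C D Z :: "'u mdspace"
  assumes "md_pushout A B C D i f g j" "multipointed_d_space Z" "u \<in> md_hom B Z" "v \<in> md_hom C Z"
    and "\<And>a. a \<in> topspace (mdtop A) \<Longrightarrow> u (i a) = v (f a)"
  obtains w where "w \<in> md_hom D Z" "\<And>b. b \<in> topspace (mdtop B) \<Longrightarrow> w (g b) = u b"
    "\<And>c. c \<in> topspace (mdtop C) \<Longrightarrow> w (j c) = v c"
proof -
  have "md_comp A u i = md_comp A v f"
    using assms(5) by (simp add: md_comp_eq_iff)
  from md_pushout_universal[OF assms(1-4) this, THEN ex1_implies_ex] obtain w
    where w: "w \<in> md_hom D Z" "md_comp B w g = u" "md_comp C w j = v"
    by (elim exE conjE)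
  show thesis
  proof (rule that[OF w(1)])
    show "w (g b) = u b" if "b \<in> topspace (mdtop B)" for b
      using fun_cong[OF w(2), of b] that by (simp add: md_comp_apply)
    show "w (j c) = v c" if "c \<in> topspace (mdtop C)" for c
      using fun_cong[OF w(3), of c] that by (simp add: md_comp_apply)
  qed
qed

text \<open>The map \<open>w\<close> itself supplies a cocone, namely its composites with
  \<open>g\<close> and \<open>j\<close>; both \<open>w\<close> and \<open>w'\<close> mediate
  it.\<close>

lemma md_pushout_unique:
  fixes A B C D Z :: "'u mdspace"
  assumes "md_pushout A B C D i f g j" "multipointed_d_space Z" "w \<in> md_hom D Z" "w' \<in> md_hom D Z"
    and "\<And>b. b \<in> topspace (mdtop B) \<Longrightarrow> w (g b) = w' (g b)"
    and "\<And>c. c \<in> topspace (mdtop C) \<Longrightarrow> w (j c) = w' (j c)"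
  shows "w = w'"
proof -
  note P = md_pushoutD[OF assms(1)]
  have "md_comp B w g \<in> md_hom B Z" "md_comp C w j \<in> md_hom C Z"
    using assms(3) P by (auto intro: md_comp_in_md_hom)
  moreover have "md_comp A (md_comp B w g) i = md_comp A (md_comp C w j) f"
    using P md_homD(3)[OF P(5)] md_homD(3)[OF P(6)] md_pushout_commute[OF assms(1)]
    by (simp add: md_comp_eq_iff md_comp_apply)
  ultimately have "\<exists>!x. x \<in> md_hom D Z \<and> md_comp B x g = md_comp B w g \<and> md_comp C x j = md_comp C w j"
    by (rule md_pushout_universal[OF assms(1,2)])
  then obtain x where x: "\<forall>y. y \<in> md_hom D Z \<and> md_comp B y g = md_comp B w g \<and> md_comp C y j = md_comp C w j
      \<longrightarrow> y = x"
    by (rule ex1E)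
  have "w = x"
    using assms(3) by (intro x[rule_format]) simp
  moreover have "w' = x"
    using assms(4-6) by (intro x[rule_format]) (simp add: md_comp_eq_iff)
  ultimately show ?thesis
    by simp
qed

text \<open>
  The space \<open>Z\<close> below is \<open>D\<close> cut down to the images of \<open>B\<close> and \<open>C\<close> and retopologised with the
  final topology; its distinguished paths are those of \<open>D\<close> that stay continuous.  The map
  \<open>D \<rightarrow> Z\<close> given by the universal property must be the identity.
\<close>

lemma md_pushout_final:
  fixes A B C D :: "'u mdspace"
  assumes PO: "md_pushout A B C D i f g j"
  shows "mdtop D = final_topology2 (mdtop B) (mdtop C) g j"
    and "states D \<subseteq> g ` states B \<union> j ` states C"
proof -
  note P = md_pushoutD[OF PO]
  note dB = multipointed_d_spaceD[OF P(2)] and dC = multipointed_d_spaceD[OF P(3)]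
    and dD = multipointed_d_spaceD[OF P(4)] and gD = md_homD[OF P(7)] and jD = md_homD[OF P(8)]
  define F where "F = final_topology2 (mdtop B) (mdtop C) g j"
  define S where "S = g ` states B \<union> j ` states C"
  \<comment> \<open>A priori \<open>S\<close> may be smaller than \<open>states D\<close>, so the
    endpoints of paths are required to lie in \<open>S\<close>.\<close>
  define Z where "Z = \<lparr>mdtop = F, states = S,
    paths = {p \<in> paths D. pathin F p \<and> p 0 \<in> S \<and> p 1 \<in> S}\<rparr>"
  have topF: "topspace F = g ` topspace (mdtop B) \<union> j ` topspace (mdtop C)"
    by (simp add: F_def topspace_final_topology2)
  have gF: "continuous_map (mdtop B) F g" and jF: "continuous_map (mdtop C) F j"
    by (simp_all add: F_def continuous_map_final_topology2)
  have SD: "S \<subseteq> states D"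
    using gD(4) jD(4) by (auto simp: S_def)
  have openF: "openin F (topspace F \<inter> U)" if "openin (mdtop D) U" for U
  proof -
    have "{b \<in> topspace (mdtop B). g b \<in> topspace F \<inter> U} = {b \<in> topspace (mdtop B). g b \<in> U}"
      "{c \<in> topspace (mdtop C). j c \<in> topspace F \<inter> U} = {c \<in> topspace (mdtop C). j c \<in> U}"
      by (auto simp: topF)
    then show ?thesis
      using openin_continuous_map_preimage[OF gD(2) that] openin_continuous_map_preimage[OF jD(2) that]
      by (simp add: F_def openin_final_topology2 topF[unfolded F_def])
  qed
  have FD: "topspace F \<subseteq> topspace (mdtop D)"
    using gD(3) jD(3) by (auto simp: topF)
  have idF: "continuous_map F (mdtop D) id"
    unfolding continuous_map_def
  proof (intro conjI allI impI)
    show "id \<in> topspace F \<rightarrow> topspace (mdtop D)"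
      using FD by auto
    fix U assume "openin (mdtop D) U"
    then show "openin F {x \<in> topspace F. id x \<in> U}"
      using openF[of U] by (simp add: Int_def)
  qed
  have Z: "multipointed_d_space Z"
    unfolding multipointed_d_space_def
  proof (intro conjI ballI allI impI)
    show "delta_generated (mdtop Z)"
      using dB(1) dC(1) by (simp add: Z_def F_def delta_generated_final_topology2)
    show "states Z \<subseteq> topspace (mdtop Z)"
      using dB(2) dC(2) by (auto simp: Z_def S_def topF)
  next
    fix p q assume "p \<in> paths Z" "q \<in> paths Z" "p 1 = q 0"
    then show "path_concat p q \<in> paths Z"
      using pathin_path_concat[of F p q] dD(7) by (auto simp: Z_def path_concat_def)
  next
    fix p and \<psi> :: "real \<Rightarrow> real"
    assume p: "p \<in> paths Z" and
      \<psi>: "continuous_on {0..1} \<psi> \<and> strict_mono_on {0..1} \<psi> \<and> \<psi> 0 = 0 \<and> \<psi> 1 = 1"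
    \<comment> \<open>Monotonicity and the fixed endpoints keep the reparametrisation inside the
      interval.\<close>
    have "\<psi> ` {0..1} \<subseteq> {0..1}"
    proof (rule image_subsetI)
      fix x :: real assume x: "x \<in> {0..1}"
      then have "\<psi> 0 \<le> \<psi> x" "\<psi> x \<le> \<psi> 1"
        using \<psi> strict_mono_on_leD[of "{0..1}" \<psi> 0 x] strict_mono_on_leD[of "{0..1}" \<psi> x 1] by auto
      then show "\<psi> x \<in> {0..1}"
        using \<psi> by simp
    qed
    then have "continuous_map (top_of_set {0..1}) (top_of_set {0..1}) \<psi>"
      using \<psi> by auto
    moreover have "continuous_map (top_of_set {0..1}) F p"
      using p by (simp add: Z_def pathin_def)
    ultimately have "continuous_map (top_of_set {0..1}) F (p \<circ> \<psi>)"
      by (rule continuous_map_compose)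
    then have "pathin F (compose {0..1} p \<psi>)"
      unfolding pathin_def by (rule continuous_map_eq) (simp add: compose_def)
    then show "compose {0..1} p \<psi> \<in> paths Z"
      using p \<psi> dD(8)[of p \<psi>] by (auto simp: Z_def compose_def)
  qed (use dD in \<open>auto simp: Z_def\<close>)
  \<comment> \<open>A morphism into \<open>D\<close> is one into \<open>Z\<close> once it is
    continuous into \<open>F\<close> and sends states into \<open>S\<close>; the condition on paths
    then follows.\<close>
  have hom: "k \<in> md_hom X Z"
    if X: "multipointed_d_space X" and k: "k \<in> md_hom X D" and kF: "continuous_map (mdtop X) F k"
      and kS: "k ` states X \<subseteq> S" for k and X :: "'u mdspace"
  proof (rule md_homI)
    fix p assume p: "p \<in> paths X"
    have "pathin F (k \<circ> p)"
      using pathin_compose[OF multipointed_d_spaceD(4)[OF X p] kF] .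
    then have "pathin F (compose {0..1} k p)"
      unfolding pathin_def by (rule continuous_map_eq) (simp add: compose_def)
    then show "compose {0..1} k p \<in> paths Z"
      using md_homD(5)[OF k p] kS multipointed_d_spaceD(5,6)[OF X p]
      by (auto simp: Z_def compose_def)
  qed (use md_homD(1)[OF k] kF kS in \<open>auto simp: Z_def\<close>)
  have "g \<in> md_hom B Z" "j \<in> md_hom C Z"
    using hom P gF jF by (auto simp: S_def)
  from md_pushout_induced[OF PO Z this md_pushout_commute[OF PO]] obtain w where w: "w \<in> md_hom D Z"
    and wg: "\<And>b. b \<in> topspace (mdtop B) \<Longrightarrow> w (g b) = g b"
    and wj: "\<And>c. c \<in> topspace (mdtop C) \<Longrightarrow> w (j c) = j c"
    by metis
  \<comment> \<open>Since \<open>F\<close> is finer than the subspace topology from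
    \<open>D\<close>, \<open>w\<close> is also an endomorphism of \<open>D\<close>; it agrees with
    the identity on both images, so uniqueness applies.\<close>
  have "w \<in> md_hom D D"
  proof (rule md_homI)
    show "continuous_map (mdtop D) (mdtop D) w"
      using continuous_map_compose[OF md_homD(2)[OF w], of "mdtop D" id] idF by (simp add: Z_def)
  qed (use md_homD(1,4,5)[OF w] SD in \<open>auto simp: Z_def\<close>)
  then have w_id: "w = md_id D"
    using PO P(4) md_id_in_md_hom[OF P(4)] wg wj gD(3) jD(3)
    by (intro md_pushout_unique[where w = w and w' = "md_id D"]) (auto simp: md_id_def)
  then have w_apply: "w x = x" if "x \<in> topspace (mdtop D)" for x
    using that by (simp add: md_id_def)
  show "states D \<subseteq> g ` states B \<union> j ` states C"
  proof
    fix x assume x: "x \<in> states D"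
    then have "w x = x"
      using w_apply dD(2) by blast
    then show "x \<in> g ` states B \<union> j ` states C"
      using md_homD(4)[OF w x] by (simp add: Z_def S_def)
  qed
  have DF: "topspace (mdtop D) = topspace F"
    using FD md_homD(3)[OF w] w_apply by (auto simp: Z_def)
  \<comment> \<open>Continuity of \<open>w\<close> into \<open>F\<close>, with \<open>w\<close> the
    identity on points, says exactly that \<open>F\<close> is no finer than
    \<open>D\<close>.\<close>
  have "openin (mdtop D) U" if "openin F U" for U
  proof -
    have "openin (mdtop D) {x \<in> topspace (mdtop D). w x \<in> U}"
      using openin_continuous_map_preimage[OF md_homD(2)[OF w], of U] that by (simp add: Z_def)
    moreover have "{x \<in> topspace (mdtop D). w x \<in> U} = U"
      using openin_subset[OF that] DF w_apply by auto
    ultimately show ?thesis by simp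
  qed
  moreover have "openin F U" if "openin (mdtop D) U" for U
    using openF[OF that] openin_subset[OF that] DF by (simp add: Int_absorb1)
  ultimately show "mdtop D = final_topology2 (mdtop B) (mdtop C) g j"
    unfolding topology_eq F_def by blast
qed

section \<open>The deformation retraction of the pushout\<close>

theorem theorem5p9:
  fixes A B C D :: "'u mdspace" and i f g j :: "'u \<Rightarrow> 'u"
  assumes "infinite (UNIV :: 'u set)"
    and "md_pushout A B C D i f g j"
    and "sdr_inclusion A B i"
  shows "sdr_inclusion C D j"
proof -
  let ?I = "top_of_set {0..1::real}"
  note PO = assms(2)
  note P = md_pushoutD[OF PO]
  note iD = md_homD[OF P(5)] and fD = md_homD[OF P(6)] and gD = md_homD[OF P(7)] and jD = md_homD[OF P(8)]
  from assms(3) obtain H r where H: "continuous_map ?I (MDTOP_delta B B) H"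
    and r: "r \<in> md_hom B A" and H0: "H 0 = md_id B" and H1: "H 1 = md_comp B i r"
    and ri: "md_comp A r i = md_id A"
    and Hi: "\<And>a t. a \<in> topspace (mdtop A) \<Longrightarrow> t \<in> {0..1} \<Longrightarrow> H t (i a) = i a"
    unfolding sdr_inclusion_def by blast
  have Hhom: "\<And>t. t \<in> {0..1} \<Longrightarrow> H t \<in> md_hom B B"
    and Hco: "continuous_map ?I (compact_open (mdtop B) (mdtop B)) H"
    and Hst: "\<And>t b. t \<in> {0..1} \<Longrightarrow> b \<in> states B \<Longrightarrow> H t b = H 0 b"
    using H unfolding continuous_map_interval_MDTOP_delta_iff by blast+
  have ria: "r (i a) = a" if "a \<in> topspace (mdtop A)" for a
    using fun_cong[OF ri, of a] that by (simp add: md_comp_apply md_id_def)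
  have topD: "topspace (mdtop D) = g ` topspace (mdtop B) \<union> j ` topspace (mdtop C)"
    by (simp add: md_pushout_final(1)[OF PO] topspace_final_topology2)
  \<comment> \<open>The cocone is \<open>f \<circ> r\<close> on \<open>B\<close> and the identity on
    \<open>C\<close>; it is compatible because \<open>r \<circ> i\<close> is the identity.\<close>
  obtain r' where r': "r' \<in> md_hom D C"
    and r'g: "\<And>b. b \<in> topspace (mdtop B) \<Longrightarrow> r' (g b) = f (r b)"
    and r'j: "\<And>c. c \<in> topspace (mdtop C) \<Longrightarrow> r' (j c) = c"
  proof (rule md_pushout_induced[OF PO P(3) md_comp_in_md_hom[OF P(2) r P(6)] md_id_in_md_hom[OF P(3)]])
    show "md_comp B f r (i a) = md_id C (f a)" if "a \<in> topspace (mdtop A)" for a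
      using that ria iD(3) fD(3) by (simp add: md_comp_apply md_id_def)
  qed (auto simp: md_comp_apply md_id_def)
  have "\<exists>w. w \<in> md_hom D D \<and> (\<forall>b \<in> topspace (mdtop B). w (g b) = g (H t b)) \<and>
      (\<forall>c \<in> topspace (mdtop C). w (j c) = j c)" if t: "t \<in> {0..1}" for t
  proof -
    \<comment> \<open>Compatibility of the cocone \<open>g \<circ> H t\<close>, \<open>j\<close> is
      where it matters that the deformation fixes the image of \<open>A\<close> at all
      times.\<close>
    have "md_comp B g (H t) (i a) = j (f a)" if "a \<in> topspace (mdtop A)" for a
      using that t Hi iD(3) md_pushout_commute[OF PO] by (simp add: md_comp_apply)
    from md_pushout_induced[OF PO P(4) md_comp_in_md_hom[OF P(2) Hhom[OF t] P(7)] P(8) this]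
    show ?thesis
      by (metis md_comp_apply)
  qed
  then obtain H' where H'hom: "\<And>t. t \<in> {0..1} \<Longrightarrow> H' t \<in> md_hom D D"
    and H'g: "\<And>t b. t \<in> {0..1} \<Longrightarrow> b \<in> topspace (mdtop B) \<Longrightarrow> H' t (g b) = g (H t b)"
    and H'j: "\<And>t c. t \<in> {0..1} \<Longrightarrow> c \<in> topspace (mdtop C) \<Longrightarrow> H' t (j c) = j c"
    by metis
  have H'0: "H' 0 = md_id D"
    using H'hom[of 0] md_id_in_md_hom[OF P(4)] H'g[of 0] H'j[of 0] gD(3) jD(3)
    by (intro md_pushout_unique[OF PO P(4)]) (auto simp: H0 md_id_def)
  have "md_comp D j r' \<in> md_hom D D"
    using md_comp_in_md_hom[OF P(4) r' P(8)] .
  \<comment> \<open>On the image of \<open>g\<close> both sides agree since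
    \<open>g (i (r b)) = j (f (r b))\<close>; on that of \<open>j\<close> both fix every
    point.\<close>
  then have H'1: "H' 1 = md_comp D j r'"
    using H'hom[of 1] H'g[of 1] H'j[of 1] gD(3) jD(3) r'g r'j md_pushout_commute[OF PO] md_homD(3)[OF r]
    by (intro md_pushout_unique[OF PO P(4)]) (auto simp: H1 md_comp_apply)
  have H'st: "H' t x = H' 0 x" if t: "t \<in> {0..1}" and x: "x \<in> states D" for t x
  proof -
    from x md_pushout_final(2)[OF PO] consider b where "b \<in> states B" "x = g b"
      | c where "c \<in> states C" "x = j c"
      by blast
    then show ?thesis
    proof cases
      case 1
      then show ?thesis
        using H'g[of _ b] t Hst[of t b] multipointed_d_spaceD(2)[OF P(2)] by auto
    next
      case 2
      then show ?thesis
        using H'j[of _ c] t multipointed_d_spaceD(2)[OF P(3)] by auto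
    qed
  qed
  have "continuous_map ?I (compact_open (mdtop D) (mdtop D)) H'"
  proof (rule continuous_map_into_compact_openI)
    have "locally_compact_space ?I"
      by (rule compact_imp_locally_compact_space) (simp add: compact_space_subtopology)
    then show "neighbourhood_base_of (compactin ?I) ?I"
      by (meson Hausdorff_space_euclidean Hausdorff_space_subtopology
          locally_compact_space_neighbourhood_base)
    show "H' t \<in> cmaps (mdtop D) (mdtop D)" if "t \<in> topspace ?I" for t
      using H'hom[of t] that by (auto simp: md_hom_def)
  next
    fix x assume "x \<in> topspace (mdtop D)"
    then consider b where "b \<in> topspace (mdtop B)" "x = g b"
      | c where "c \<in> topspace (mdtop C)" "x = j c"
      unfolding topD by blast
    then show "continuous_map ?I (mdtop D) (\<lambda>t. H' t x)"
    proof cases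
      case 1
      from continuous_map_compose[OF continuous_map_compact_open_pointwise[OF Hco 1(1)] gD(2)]
      show ?thesis
        by (rule continuous_map_eq) (use 1 H'g in auto)
    next
      case 2
      have "continuous_map ?I (mdtop D) (\<lambda>t. j c)"
        using 2 jD(3) by simp
      then show ?thesis
        by (rule continuous_map_eq) (use 2 H'j in auto)
    qed
  next
    fix J U assume J: "compactin ?I J" and U: "openin (mdtop D) U"
    have JI: "J \<subseteq> {0..1}"
      using compactin_subset_topspace[OF J] by simp
    \<comment> \<open>Openness of \<open>?O\<close> is checked on the preimages under
      \<open>g\<close> and \<open>j\<close>. The first reduces to the compact-quantifier lemma for
      \<open>H\<close>, the second to continuity of \<open>j\<close>, as \<open>H'\<close> fixes the
      image of \<open>j\<close>.\<close>
    let ?O = "{x \<in> topspace (mdtop D). \<forall>t\<in>J. H' t x \<in> U}"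
    let ?V = "{b \<in> topspace (mdtop B). g b \<in> U}"
    have "openin (mdtop B) ?V"
      using gD(2) U by (rule openin_continuous_map_preimage)
    then have "openin (mdtop B) {b \<in> topspace (mdtop B). \<forall>t\<in>J. H t b \<in> ?V}"
      using openin_forall_compact_preimage[OF Hco multipointed_d_spaceD(1)[OF P(2)] J] by blast
    moreover have "{b \<in> topspace (mdtop B). \<forall>t\<in>J. H t b \<in> ?V} = {b \<in> topspace (mdtop B). g b \<in> ?O}"
      using JI H'g gD(3) md_homD(3)[OF Hhom] by (auto simp: subset_iff)
    moreover have "openin (mdtop C) {c \<in> topspace (mdtop C). j c \<in> ?O}"
    \<comment> \<open>For empty \<open>J\<close> the condition is vacuous and does not reduce to
      \<open>j c \<in> U\<close>.\<close>
    proof (cases "J = {}")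
      case True
      then have "{c \<in> topspace (mdtop C). j c \<in> ?O} = topspace (mdtop C)"
        using jD(3) by auto
      then show ?thesis by simp
    next
      case False
      then have "{c \<in> topspace (mdtop C). j c \<in> ?O} = {c \<in> topspace (mdtop C). j c \<in> U}"
        using JI H'j jD(3) by (auto simp: subset_iff)
      then show ?thesis
        using openin_continuous_map_preimage[OF jD(2) U] by simp
    qed
    ultimately have "openin (final_topology2 (mdtop B) (mdtop C) g j) ?O"
      using topD by (auto simp: openin_final_topology2)
    then show "openin (mdtop D) ?O"
      by (simp add: md_pushout_final(1)[OF PO])
  qed
  then have "continuous_map ?I (MDTOP_delta D D) H'"
    using H'hom H'st unfolding continuous_map_interval_MDTOP_delta_iff by blast
  moreover have "md_comp C r' j = md_id C"
    using r'j by (intro md_comp_eqI[OF md_id_in_md_hom[OF P(3)]]) (simp add: md_id_def)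
  ultimately show ?thesis
    unfolding sdr_inclusion_def using P r' H'0 H'1 H'j by blast
qed

end
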